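(* Let $\mathcal{A}$ be a Rickart *-ring and $b\in\mathcal{A}$. Put $b_r=\mathrm{rp}(b)\,b$. Then: (a) the poset $[0,b]^{r*|\ell\square}=\{a\in\mathcal{A}: a\preceq^{r*|\ell\square} b\}$ is order-isomorphic to $E_b^{r*|\ell\square}=\{p\in E(\mathcal{A}): p\le \mathrm{rp}(b),\ p b_r p=p b_r\}$; (b) the poset $[0,b]^{r*|r\square}=\{a\in\mathcal{A}: a\preceq^{r*|r\square} b\}$ is order-isomorphic to $E_b^{r*|r\square}=\{p\in E(\mathcal{A}): p\le \mathrm{rp}(b),\ p b_r p=b_r p\}$; (c) the poset $[0,b]^{r*|\square}=\{a\in\mathcal{A}: a\preceq^{r*|\square} b\}$ is order-isomorphic to $E_b^{r*|\square}=\{p\in E(\mathcal{A}): p\le \mathrm{rp}(b),\ p b_r=b_r p\}$. Here each $[0,b]^{\alpha}$ is ordered by the corresponding $\preceq^{\alpha}$ and each $E_b^{\alpha}$ is ordered by $\le$.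
   Context: A *-ring is an (associative) ring $\mathcal{A}$ with an involution $*$: $(a+b)^*=a^*+b^*$, $(ab)^*=b^*a^*$, $(a^* )^*=a$. It is a Rickart *-ring if for every $a\in\mathcal{A}$ there is a self-adjoint idempotent $p$ (i.e. $p=p^*=p^2$) with $\{x\in\mathcal{A}: xa=0\}=\mathcal{A}(1-p)$; such a ring has an identity $1$, and $p$ is unique and denoted $\mathrm{lp}(a)$. Likewise, for every $a$ there is a unique self-adjoint idempotent $\mathrm{rp}(a)$ with $\{x\in\mathcal{A}: ax=0\}=(1-\mathrm{rp}(a))\mathcal{A}$. $E(\mathcal{A})$ is the set of self-adjoint idempotents, partially ordered by $p\le q$ iff $p=pq$. The following are partial orders on $\mathcal{A}$: $a\preceq^{r*|\ell\square} b$ iff $a\,\mathrm{rp}(b)=a=b\,\mathrm{rp}(a)$ and $a^2=ab$; $a\preceq^{r*|r\square} b$ iff $a\,\mathrm{rp}(b)=a=b\,\mathrm{rp}(a)$ and $a^2=ba$; $a\preceq^{r*|\square} b$ iff $a\,\mathrm{rp}(b)=a=b\,\mathrm{rp}(a)$ and $a^2=ab=ba$. Two posets are order-isomorphic if there is a bijection between them which is order-preserving with order-preserving inverse. *)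

theory Defs
  imports Main
begin

class star_ring = ring +
  fixes star :: "'a \<Rightarrow> 'a"
  assumes star_add: "star (a + b) = star a + star b"
    and star_mult: "star (a * b) = star b * star a"
    and star_star [simp]: "star (star a) = a"

definition (in star_ring) projections :: "'a set" where
  "projections = {p. p = star p \<and> p = p * p}"

definition proj_le :: "'a::star_ring \<Rightarrow> 'a \<Rightarrow> bool" where
  "proj_le p q \<longleftrightarrow> p = p * q"

text \<open>
  The identity comes from \<open>monoid_mult\<close> and not from \<open>ring_1\<close>, because \<open>ring_1\<close>
  would exclude the zero ring.
\<close>

class rickart_star_ring = star_ring + monoid_mult +
  assumes rickart: "\<exists>p \<in> projections. {x. x * a = 0} = {x * (1 - p) | x. True}"

definition rp :: "'a::rickart_star_ring \<Rightarrow> 'a" where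
  "rp a = (THE p. p \<in> projections \<and> {x. a * x = 0} = {(1 - p) * x | x. True})"

lemma ex1_rp:
  fixes a :: "'a::rickart_star_ring"
  shows "\<exists>!p. p \<in> projections \<and> {x. a * x = 0} = {(1 - p) * x | x. True}"
proof -
  have star_diff: "star (x - y) = star x - star y" for x y :: 'a
    using star_add[of "x - y" y] by (simp add: algebra_simps)
  have star_one: "star 1 = (1::'a)"
    by (metis mult_1_left mult_1_right star_mult star_star)
  have star_zero: "star 0 = (0::'a)"
    using star_diff[of 0 0] by simp
  obtain p where p: "p \<in> projections" "{x. x * star a = 0} = {x * (1 - p) | x. True}"
    using rickart by blast
  have sp: "star (1 - p) = 1 - p"
    using p(1) by (simp add: projections_def star_diff star_one)
  have "a * x = 0 \<longleftrightarrow> (\<exists>y. x = (1 - p) * y)" for x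
  proof -
    have "a * x = 0 \<longleftrightarrow> star x * star a = 0"
      by (metis star_mult star_star star_zero)
    also have "\<dots> \<longleftrightarrow> (\<exists>y. star x = y * (1 - p))"
      using p(2) by blast
    also have "\<dots> \<longleftrightarrow> (\<exists>y. x = (1 - p) * y)"
      by (metis sp star_mult star_star)
    finally show ?thesis .
  qed
  then have ex: "p \<in> projections \<and> {x. a * x = 0} = {(1 - p) * x | x. True}"
    using p(1) by blast
  have le: "q = q * r"
    if q: "q \<in> projections" "{x. a * x = 0} = {(1 - q) * x | x. True}"
      and r: "r \<in> projections" "{x. a * x = 0} = {(1 - r) * x | x. True}" for q r
  proof -
    have "1 - r \<in> {(1 - q) * x | x. True}"
      unfolding q(2)[symmetric] r(2) by (auto intro: exI[of _ 1])
    then obtain y where "1 - r = (1 - q) * y"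
      by blast
    then have "q * (1 - r) = (q - q * q) * y"
      by (simp add: left_diff_distrib right_diff_distrib mult.assoc)
    moreover have "q * q = q"
      using q(1) by (simp add: projections_def)
    ultimately show ?thesis
      by (simp add: right_diff_distrib)
  qed
  show ?thesis
  proof (rule ex1I[of _ p])
    fix q assume q: "q \<in> projections \<and> {x. a * x = 0} = {(1 - q) * x | x. True}"
    have "p = p * q" "q = q * p"
      using le ex q by blast+
    moreover have "star p = p" "star q = q"
      using ex q by (simp_all add: projections_def)
    ultimately show "q = p"
      by (metis star_mult)
  qed (rule ex)
qed

definition le_rstar_lsq :: "'a::rickart_star_ring \<Rightarrow> 'a \<Rightarrow> bool" where
  "le_rstar_lsq a b \<longleftrightarrow> a * rp b = a \<and> a = b * rp a \<and> a ^ 2 = a * b"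

definition le_rstar_rsq :: "'a::rickart_star_ring \<Rightarrow> 'a \<Rightarrow> bool" where
  "le_rstar_rsq a b \<longleftrightarrow> a * rp b = a \<and> a = b * rp a \<and> a ^ 2 = b * a"

definition le_rstar_sq :: "'a::rickart_star_ring \<Rightarrow> 'a \<Rightarrow> bool" where
  "le_rstar_sq a b \<longleftrightarrow> a * rp b = a \<and> a = b * rp a \<and> a ^ 2 = a * b \<and> a ^ 2 = b * a"

definition order_isomorphic ::
    "'a set \<Rightarrow> ('a \<Rightarrow> 'a \<Rightarrow> bool) \<Rightarrow> 'b set \<Rightarrow> ('b \<Rightarrow> 'b \<Rightarrow> bool) \<Rightarrow> bool" where
  "order_isomorphic A leA B leB \<longleftrightarrow>
    (\<exists>f. bij_betw f A B \<and> monotone_on A leA leB f \<and> monotone_on B leB leA (inv_into A f))"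

end

theory Submission
  imports Defs
begin

text \<open>
  The isomorphism sends \<open>a\<close> to \<open>rp a\<close>, with inverse \<open>p \<mapsto> b * p\<close>. Since \<open>b * x = b * y\<close>
  is equivalent to \<open>rp b * x = rp b * y\<close>, one gets \<open>rp (b * p) = p\<close> for every projection
  \<open>p \<le> rp b\<close>, and the left factor \<open>b\<close> in the conditions on \<open>a\<^sup>2\<close> for \<open>a = b * p\<close>
  may be replaced by \<open>rp b\<close>, which turns them into the conditions on \<open>p\<close>.
\<close>

text \<open>An explicit inverse \<open>g\<close> replaces \<open>inv_into A f\<close>, with which it
  agrees on \<open>B\<close>.\<close>

lemma order_isomorphicI:
  assumes f: "\<And>a. a \<in> A \<Longrightarrow> f a \<in> B"
    and g: "\<And>p. p \<in> B \<Longrightarrow> g p \<in> A"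
    and gf: "\<And>a. a \<in> A \<Longrightarrow> g (f a) = a"
    and fg: "\<And>p. p \<in> B \<Longrightarrow> f (g p) = p"
    and mono_f: "\<And>a c. a \<in> A \<Longrightarrow> c \<in> A \<Longrightarrow> leA a c \<Longrightarrow> leB (f a) (f c)"
    and mono_g: "\<And>p q. p \<in> B \<Longrightarrow> q \<in> B \<Longrightarrow> leB p q \<Longrightarrow> leA (g p) (g q)"
  shows "order_isomorphic A leA B leB"
proof -
  have bij: "bij_betw f A B"
    by (rule bij_betw_byWitness[where f' = g]) (use f g gf fg in auto)
  have "inv_into A f p = g p" if "p \<in> B" for p
    using that bij f g fg by (metis bij_betw_inv_into_left)
  then have "monotone_on B leB leA (inv_into A f)"
    using mono_g by (simp add: monotone_on_def)
  moreover have "monotone_on A leA leB f"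
    using mono_f by (simp add: monotone_on_def)
  ultimately show ?thesis
    using bij unfolding order_isomorphic_def by blast
qed

text \<open>Taking adjoints in \<open>p = p * q\<close> reverses the product and fixes both
  projections.\<close>

lemma proj_le_commute:
  assumes "p \<in> projections" "q \<in> projections" "proj_le p q"
  shows "q * p = p"
  using assms unfolding projections_def proj_le_def
  by (metis (mono_tags, lifting) mem_Collect_eq star_mult)

text \<open>This lets the set equation defining \<open>rp a\<close> be read as equality of the right
  annihilators of \<open>a\<close> and \<open>rp a\<close>.\<close>

lemma projection_annihilates_iff:
  fixes p :: "'a::rickart_star_ring"
  assumes "p \<in> projections"
  shows "p * x = 0 \<longleftrightarrow> (\<exists>y. x = (1 - p) * y)"
proof
  assume "p * x = 0"
  then have "x = (1 - p) * x"
    by (simp add: left_diff_distrib)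
  then show "\<exists>y. x = (1 - p) * y" ..
next
  have "p * p = p"
    using assms by (simp add: projections_def)
  then have "p * (1 - p) = 0"
    by (simp add: right_diff_distrib)
  moreover assume "\<exists>y. x = (1 - p) * y"
  ultimately show "p * x = 0"
    by (metis mult.assoc mult_zero_left)
qed

lemma rp_projection: "rp a \<in> projections"
  and mult_eq_0_iff_rp: "a * x = 0 \<longleftrightarrow> rp a * x = 0"
proof -
  have rp: "rp a \<in> projections \<and> {x. a * x = 0} = {(1 - rp a) * x | x. True}"
    unfolding rp_def by (rule theI'[OF ex1_rp])
  then show "rp a \<in> projections" ..
  then show "a * x = 0 \<longleftrightarrow> rp a * x = 0"
    using rp projection_annihilates_iff by blast
qed

lemma rp_eqI:
  assumes "p \<in> projections" "\<And>x. a * x = 0 \<longleftrightarrow> p * x = 0"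
  shows "rp a = p"
  unfolding rp_def
proof (rule the1_equality[OF ex1_rp])
  show "p \<in> projections \<and> {x. a * x = 0} = {(1 - p) * x | x. True}"
    using assms projection_annihilates_iff by blast
qed

lemma mult_left_eq_iff_rp: "a * x = a * y \<longleftrightarrow> rp a * x = rp a * y"
  using mult_eq_0_iff_rp[of a "x - y"] by (simp add: right_diff_distrib)

text \<open>Cancellation against \<open>1\<close>. It identifies the clause
  \<open>a * rp c = a\<close> of the three orders with \<open>proj_le (rp a) (rp c)\<close>.\<close>

lemma mult_projection_eq_iff_proj_le: "a * q = a \<longleftrightarrow> proj_le (rp a) q"
  using mult_left_eq_iff_rp[of a q 1] by (auto simp: proj_le_def)

lemma rp_mult_projection:
  assumes "p \<in> projections" "proj_le p (rp b)"
  shows "rp (b * p) = p"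
proof (rule rp_eqI)
  show "b * p * x = 0 \<longleftrightarrow> p * x = 0" for x
    using mult_eq_0_iff_rp[of b "p * x"] proj_le_commute[OF assms(1) rp_projection assms(2)]
    by (simp flip: mult.assoc)
qed (rule assms)

text \<open>
  The three partial orders differ only in the condition on \<open>a\<^sup>2\<close>, abstracted here as \<open>S\<close>;
  \<open>Q\<close> is its translation into a condition on projections.
\<close>

lemma order_isomorphic_rp:
  fixes b :: "'a::rickart_star_ring"
  assumes le: "\<And>a c. le a c \<longleftrightarrow> a * rp c = a \<and> a = c * rp a \<and> S a c"
    and Q: "\<And>p. p \<in> projections \<Longrightarrow> proj_le p (rp b) \<Longrightarrow> S (b * p) b \<longleftrightarrow> Q p"
    and mono: "\<And>p q. p * q = p \<Longrightarrow> q * p = p \<Longrightarrow> S (b * p) b \<Longrightarrow> S (b * q) b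
      \<Longrightarrow> S (b * p) (b * q)"
  shows "order_isomorphic {a. le a b} le {p \<in> projections. proj_le p (rp b) \<and> Q p} proj_le"
    (is "order_isomorphic ?A _ ?B _")
proof (rule order_isomorphicI[of _ rp _ "\<lambda>p. b * p"])
  show "rp a \<in> ?B" if "a \<in> ?A" for a
    \<comment> \<open>Since \<open>a = b * rp a\<close>, the condition \<open>S a b\<close> is the
      instance of \<open>Q\<close> at \<open>rp a\<close>.\<close>
    using that Q[of "rp a"] rp_projection[of a] mult_projection_eq_iff_proj_le[of a "rp b"]
    by (simp add: le)
next
  fix p assume p: "p \<in> ?B"
  then show fg: "rp (b * p) = p"
    by (simp add: rp_mult_projection)
  have "p * rp b = p"
    using p by (simp add: proj_le_def)
  then show "b * p \<in> ?A"
    using p Q fg by (simp add: le mult.assoc)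
next
  show "b * rp a = a" if "a \<in> ?A" for a
    using that by (simp add: le)
next
  show "proj_le (rp a) (rp c)" if "le a c" for a c
    using that by (simp add: le flip: mult_projection_eq_iff_proj_le)
next
  fix p q assume p: "p \<in> ?B" and q: "q \<in> ?B" and pq: "proj_le p q"
  have "rp (b * p) = p" "rp (b * q) = q"
    using p q by (simp_all add: rp_mult_projection)
  moreover have "p * q = p" "q * p = p"
    using p q pq proj_le_commute[of p q] by (simp_all add: proj_le_def)
  moreover have "S (b * p) b" "S (b * q) b"
    using p q Q by simp_all
  \<comment> \<open>The first two clauses reduce to \<open>b * (p * q) = b * p\<close> and
    \<open>b * p = b * (q * p)\<close>; the third is \<open>mono\<close>.\<close>
  ultimately show "le (b * p) (b * q)"
    using mono by (simp add: le mult.assoc)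
qed

text \<open>Cancelling the left \<open>b\<close> in \<open>b * p * b * p = b * p * b\<close> leaves
  \<open>p * b * p = p * b\<close>, because \<open>rp b * p = p\<close>. As
  \<open>p * rp b = p\<close>, here \<open>p * b\<close> is \<open>p * (rp b * b)\<close>.\<close>

lemma square_mult_projection_left_iff:
  fixes b :: "'a::rickart_star_ring"
  assumes "p \<in> projections" "proj_le p (rp b)"
  shows "(b * p)\<^sup>2 = b * p * b \<longleftrightarrow> p * (rp b * b) * p = p * (rp b * b)"
proof -
  have "rp b * p = p" "p * rp b = p"
    using proj_le_commute[OF assms(1) rp_projection assms(2)] assms(2)
    by (simp_all add: proj_le_def)
  then show ?thesis
    using mult_left_eq_iff_rp[of b "p * b * p" "p * b"]
    by (simp add: power2_eq_square flip: mult.assoc)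
qed

text \<open>Here the cancelled \<open>b\<close> leaves \<open>rp b\<close> in front of
  \<open>b * p\<close> on the right-hand side.\<close>

lemma square_mult_projection_right_iff:
  fixes b :: "'a::rickart_star_ring"
  assumes "p \<in> projections" "proj_le p (rp b)"
  shows "(b * p)\<^sup>2 = b * (b * p) \<longleftrightarrow> p * (rp b * b) * p = rp b * b * p"
proof -
  have "rp b * p = p" "p * rp b = p"
    using proj_le_commute[OF assms(1) rp_projection assms(2)] assms(2)
    by (simp_all add: proj_le_def)
  then show ?thesis
    using mult_left_eq_iff_rp[of b "p * b * p" "b * p"]
    by (simp add: power2_eq_square flip: mult.assoc)
qed

text \<open>Multiply the second assumption on the right by \<open>q\<close> and absorb
  \<open>q\<close> into \<open>p\<close>.\<close>

lemma square_mult_left_mono: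
  fixes b p q :: "'a::monoid_mult"
  assumes "p * q = p" "(b * p)\<^sup>2 = b * p * b"
  shows "(b * p)\<^sup>2 = b * p * (b * q)"
  using assms by (metis mult.assoc power2_eq_square)

text \<open>Multiplying the equation for \<open>q\<close> on the right by \<open>p\<close> gives
  \<open>b * q * b * p = b * b * p\<close>, which is the square of \<open>b * p\<close>.\<close>

lemma square_mult_right_mono:
  fixes b p q :: "'a::monoid_mult"
  assumes "q * p = p" "(b * p)\<^sup>2 = b * (b * p)" "(b * q)\<^sup>2 = b * (b * q)"
  shows "(b * p)\<^sup>2 = b * q * (b * p)"
  using assms by (metis mult.assoc power2_eq_square)

theorem theorem19:
  fixes b b_r :: "'a::rickart_star_ring"
  assumes b_r: "b_r = rp b * b"
  shows "order_isomorphic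
           {a. le_rstar_lsq a b} le_rstar_lsq
           {p \<in> projections. proj_le p (rp b) \<and> p * b_r * p = p * b_r} proj_le
       \<and> order_isomorphic
           {a. le_rstar_rsq a b} le_rstar_rsq
           {p \<in> projections. proj_le p (rp b) \<and> p * b_r * p = b_r * p} proj_le
       \<and> order_isomorphic
           {a. le_rstar_sq a b} le_rstar_sq
           {p \<in> projections. proj_le p (rp b) \<and> p * b_r = b_r * p} proj_le"
proof (intro conjI)
  show "order_isomorphic {a. le_rstar_lsq a b} le_rstar_lsq
      {p \<in> projections. proj_le p (rp b) \<and> p * b_r * p = p * b_r} proj_le"
    unfolding b_r
    by (rule order_isomorphic_rp[where S = "\<lambda>a c. a\<^sup>2 = a * c",
          OF le_rstar_lsq_def square_mult_projection_left_iff square_mult_left_mono])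
  show "order_isomorphic {a. le_rstar_rsq a b} le_rstar_rsq
      {p \<in> projections. proj_le p (rp b) \<and> p * b_r * p = b_r * p} proj_le"
    unfolding b_r
    by (rule order_isomorphic_rp[where S = "\<lambda>a c. a\<^sup>2 = c * a",
          OF le_rstar_rsq_def square_mult_projection_right_iff square_mult_right_mono])
  show "order_isomorphic {a. le_rstar_sq a b} le_rstar_sq
      {p \<in> projections. proj_le p (rp b) \<and> p * b_r = b_r * p} proj_le"
  proof (rule order_isomorphic_rp[where S = "\<lambda>a c. a\<^sup>2 = a * c \<and> a\<^sup>2 = c * a"])
    fix p assume p: "p \<in> projections" "proj_le p (rp b)"
    have "p * p = p"
      using p(1) by (simp add: projections_def)
    \<comment> \<open>If \<open>p\<close> and \<open>b_r\<close> commute, idempotence collapses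
      \<open>p * b_r * p\<close> to either product; conversely both products equal it.\<close>
    then have "p * b_r * p = p * b_r \<and> p * b_r * p = b_r * p \<longleftrightarrow> p * b_r = b_r * p"
      by (metis mult.assoc)
    then show "(b * p)\<^sup>2 = b * p * b \<and> (b * p)\<^sup>2 = b * (b * p) \<longleftrightarrow> p * b_r = b_r * p"
      using p by (simp only: b_r square_mult_projection_left_iff square_mult_projection_right_iff)
  next
    show "(b * p)\<^sup>2 = b * p * (b * q) \<and> (b * p)\<^sup>2 = b * q * (b * p)"
      if "p * q = p" "q * p = p"
        "(b * p)\<^sup>2 = b * p * b \<and> (b * p)\<^sup>2 = b * (b * p)"
        "(b * q)\<^sup>2 = b * q * b \<and> (b * q)\<^sup>2 = b * (b * q)" for p q
      using that square_mult_left_mono square_mult_right_mono by blast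
  qed (simp only: le_rstar_sq_def)
qed

end
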